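(* Let $H$ be a separable infinite-dimensional complex Hilbert space, let $D \subset H\setminus\{0\}$ be a countable dense subset of $H$, and let $R>1$. Let $B_R=\{T\in L(H): \|T\|\le R\}$. Then the set $L_{HC}(D)$ of operators $T\in B_R$ for which every $x\in D$ is a hypercyclic vector is a dense $G_\delta$ subset of $B_R$, where $B_R$ carries the (relative) strong operator topology.
   Context: $L(H)$ denotes the bounded linear operators on $H$. For $T\in L(H)$, a vector $x\in H$ is hypercyclic for $T$ if the orbit $\{x,Tx,T^2x,\dots\}$ is norm-dense in $H$. *)

theory Defs
  imports "HOL-Analysis.Analysis"
begin

text \<open>A complex Hilbert space is modelled as a real Banach space type 'a
  together with a complex scalar multiplication smul (extending the real one)
  and a complex inner product ip (linear in the first argument) inducing the norm.\<close>

definition complex_inner_space ::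
  "(complex \<Rightarrow> 'a::real_normed_vector \<Rightarrow> 'a) \<Rightarrow> ('a \<Rightarrow> 'a \<Rightarrow> complex) \<Rightarrow> bool" where
  "complex_inner_space smul ip \<longleftrightarrow>
     (\<forall>a b x. smul a (smul b x) = smul (a * b) x) \<and>
     (\<forall>x. smul 1 x = x) \<and>
     (\<forall>a x y. smul a (x + y) = smul a x + smul a y) \<and>
     (\<forall>a b x. smul (a + b) x = smul a x + smul b x) \<and>
     (\<forall>r x. smul (complex_of_real r) x = r *\<^sub>R x) \<and>
     (\<forall>x y z. ip (x + y) z = ip x z + ip y z) \<and>
     (\<forall>a x y. ip (smul a x) y = a * ip x y) \<and>
     (\<forall>x y. ip y x = cnj (ip x y)) \<and>
     (\<forall>x. norm x = sqrt (Re (ip x x)))"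

definition complex_span :: "(complex \<Rightarrow> 'a::real_vector \<Rightarrow> 'a) \<Rightarrow> 'a set \<Rightarrow> 'a set" where
  "complex_span smul S =
     {y. \<exists>F c. finite F \<and> F \<subseteq> S \<and> y = (\<Sum>v\<in>F. smul (c v) v)}"

definition complex_infinite_dimensional :: "(complex \<Rightarrow> 'a::real_vector \<Rightarrow> 'a) \<Rightarrow> bool" where
  "complex_infinite_dimensional smul \<longleftrightarrow>
     (\<forall>S. finite S \<longrightarrow> complex_span smul S \<noteq> UNIV)"

definition separable_space :: "'a::topological_space itself \<Rightarrow> bool" where
  "separable_space _ \<longleftrightarrow> (\<exists>C::'a set. countable C \<and> closure C = UNIV)"

definition bounded_complex_linear ::
  "(complex \<Rightarrow> 'a::real_normed_vector \<Rightarrow> 'a) \<Rightarrow> ('a \<Rightarrow> 'a) \<Rightarrow> bool" where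
  "bounded_complex_linear smul T \<longleftrightarrow>
     (\<forall>x y. T (x + y) = T x + T y) \<and>
     (\<forall>a x. T (smul a x) = smul a (T x)) \<and>
     (\<exists>K. \<forall>x. norm (T x) \<le> K * norm x)"

definition hypercyclic_vector :: "('a::topological_space \<Rightarrow> 'a) \<Rightarrow> 'a \<Rightarrow> bool" where
  "hypercyclic_vector T x \<longleftrightarrow> closure (range (\<lambda>n. (T ^^ n) x)) = UNIV"

end

theory Submission
  imports Defs
begin

text \<open>The space \<open>'a \<Rightarrow> 'a\<close> carries the topology of pointwise norm convergence, which on operators is
  the strong operator topology. On \<open>B\<close> it is completely metrizable and \<open>T \<mapsto> T\<^sup>n x\<close> is continuous, so
  by Baire it suffices that for \<open>x \<noteq> 0\<close> the operators sending \<open>x\<close> into a given ball around \<open>y\<close> at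
  some time are dense in \<open>B\<close>.

  Given \<open>T\<^sub>0 \<in> B\<close> and finitely many vectors, compress \<open>\<theta> T\<^sub>0\<close> (\<open>\<theta> < 1\<close> near \<open>1\<close>) to an operator \<open>A\<close> on a
  finite-dimensional space \<open>E\<close> containing \<open>x\<close>, \<open>y\<close>, these vectors and their images. Attach to \<open>A\<close>
  a backward shift \<open>u\<^sub>n \<mapsto> s u\<^sub>n\<^sub>-\<^sub>1 \<mapsto> \<dots> \<mapsto> s\<^sup>n u\<^sub>0 \<mapsto> s\<^sup>n \<eta> v\<close> with \<open>v \<in> E\<close> and \<open>max 1 (\<theta> R) < s < R\<close>. As \<open>s\<^sup>n\<close> beats
  both \<open>1\<close> and \<open>(\<theta> R)\<^sup>n\<close>, for large \<open>n\<close> there is \<open>v\<close> in the unit ball for which the orbit of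
  \<open>x + c u\<^sub>n\<close> hits \<open>y\<close> exactly, however small \<open>c\<close> was. Conjugating by the rank-one perturbation of the
  identity sending \<open>x\<close> to \<open>x + c u\<^sub>n\<close> moves the good vector back to \<open>x\<close>; the margin \<open>s < R\<close> absorbs the
  change of norm.\<close>

text \<open>A basic open set of the product restricts only finitely many coordinates, and finitely
  many balls admit a common positive radius. For operators this gives the usual basic neighbourhoods
  of the strong operator topology.\<close>

lemma open_fun_contains_nbhd:
  fixes U :: "('b \<Rightarrow> 'c::metric_space) set"
  assumes "open U" "f \<in> U"
  obtains F \<delta> where "finite F" "0 < \<delta>" "\<And>g. (\<And>i. i \<in> F \<Longrightarrow> dist (g i) (f i) < \<delta>) \<Longrightarrow> g \<in> U"
proof -
  obtain X where X: "f \<in> Pi\<^sub>E UNIV X" "\<And>i. open (X i)" "finite {i. X i \<noteq> UNIV}" "Pi\<^sub>E UNIV X \<subseteq> U"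
    using product_topology_open_contains_basis[of "\<lambda>_. euclidean" UNIV U f] assms
    by (auto simp: open_fun_def)
  let ?F = "{i. X i \<noteq> UNIV}"
  have "\<forall>i\<in>?F. \<forall>\<^sub>F \<delta> in at_right 0. ball (f i) \<delta> \<subseteq> X i"
  proof
    fix i
    have "f i \<in> X i"
      using X(1) by auto
    then obtain e where "0 < e" "ball (f i) e \<subseteq> X i"
      using X(2) open_contains_ball by blast
    then show "\<forall>\<^sub>F \<delta> in at_right 0. ball (f i) \<delta> \<subseteq> X i"
      by (intro eventually_at_rightI[of 0 e]) (auto simp: subset_eq)
  qed
  then have "\<forall>\<^sub>F \<delta> in at_right 0. \<forall>i\<in>?F. ball (f i) \<delta> \<subseteq> X i"
    by (rule eventually_ball_finite[OF X(3)])
  then have "\<forall>\<^sub>F \<delta> in at_right 0. 0 < \<delta> \<and> (\<forall>i\<in>?F. ball (f i) \<delta> \<subseteq> X i)"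
    using eventually_at_right_less[of "0::real"] by eventually_elim auto
  then obtain \<delta> where \<delta>: "0 < \<delta>" "\<forall>i\<in>?F. ball (f i) \<delta> \<subseteq> X i"
    using eventually_happens[of _ "at_right (0::real)"] trivial_limit_at_right_real by blast
  have "g \<in> U" if "\<And>i. i \<in> ?F \<Longrightarrow> dist (g i) (f i) < \<delta>" for g
  proof -
    have "g i \<in> X i" for i
      using that[of i] \<delta>(2) by (cases "X i = UNIV") (auto simp: subset_eq dist_commute)
    then show ?thesis
      using X(4) by auto
  qed
  then show ?thesis
    using that X(3) \<delta>(1) by blast
qed

subsection \<open>Orthonormal sets in complex inner product spaces\<close>

locale complex_inner =
  fixes smul :: "complex \<Rightarrow> 'a::real_normed_vector \<Rightarrow> 'a"
    and ip :: "'a \<Rightarrow> 'a \<Rightarrow> complex"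
  assumes complex_inner_space: "complex_inner_space smul ip"
begin

lemma smul_smul [simp]: "smul a (smul b x) = smul (a * b) x"
  and smul_one [simp]: "smul 1 x = x"
  and smul_add_right: "smul a (x + y) = smul a x + smul a y"
  and smul_add_left: "smul (a + b) x = smul a x + smul b x"
  and smul_of_real: "smul (complex_of_real r) x = r *\<^sub>R x"
  and ip_add_left: "ip (x + y) z = ip x z + ip y z"
  and ip_smul_left [simp]: "ip (smul a x) y = a * ip x y"
  and ip_commute: "ip y x = cnj (ip x y)"
  and norm_eq_sqrt_ip: "norm x = sqrt (Re (ip x x))"
  using complex_inner_space unfolding complex_inner_space_def by - metis+

sublocale smul_left: additive "\<lambda>a. smul a x" for x
  by unfold_locales (rule smul_add_left)

sublocale smul_right: additive "smul a" for a
  by unfold_locales (rule smul_add_right)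

sublocale ip_left: additive "\<lambda>x. ip x y" for y
  by unfold_locales (rule ip_add_left)

sublocale ip_right: additive "ip x" for x
  by unfold_locales (metis complex_cnj_add ip_add_left ip_commute)

lemmas smul_zero [simp] = smul_left.zero smul_right.zero
lemmas ip_zero [simp] = ip_left.zero ip_right.zero

lemma ip_smul_right [simp]: "ip x (smul a y) = cnj a * ip x y"
  by (metis complex_cnj_mult ip_commute ip_smul_left)

lemma ip_self: "ip x x = complex_of_real ((norm x)\<^sup>2)"
proof -
  have "0 \<le> Re (ip x x)"
    by (metis norm_eq_sqrt_ip norm_ge_zero real_sqrt_ge_0_iff)
  then have "Re (ip x x) = (norm x)\<^sup>2"
    by (simp add: norm_eq_sqrt_ip)
  moreover have "Im (ip x x) = 0"
    using arg_cong[OF ip_commute[of x x], of Im] by simp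
  ultimately show ?thesis
    by (simp add: complex_eq_iff)
qed

lemma norm_power2_eq_Re_ip: "(norm x)\<^sup>2 = Re (ip x x)"
  by (simp add: ip_self)

lemma norm_smul: "norm (smul a x) = cmod a * norm x"
proof -
  have "a * cnj a = complex_of_real ((cmod a)\<^sup>2)"
    by (simp only: complex_norm_square)
  then have "ip (smul a x) (smul a x) = complex_of_real ((cmod a * norm x)\<^sup>2)"
    by (simp add: ip_self[of x] power_mult_distrib mult.commute)
  then have "(norm (smul a x))\<^sup>2 = (cmod a * norm x)\<^sup>2"
    using ip_self[of "smul a x"] of_real_eq_iff by metis
  then show ?thesis
    by simp
qed

lemma bounded_linear_smul: "bounded_linear (smul a)"
proof (rule bounded_linear_intro[where K = "cmod a"])
  show "smul a (r *\<^sub>R x) = r *\<^sub>R smul a x" for r x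
    by (simp add: mult.commute flip: smul_of_real)
qed (simp_all add: smul_add_right norm_smul mult.commute)

lemma norm_add_orthogonal:
  assumes "ip x y = 0"
  shows "(norm (x + y))\<^sup>2 = (norm x)\<^sup>2 + (norm y)\<^sup>2"
  using assms ip_commute[of x y]
  by (simp add: norm_power2_eq_Re_ip ip_left.add ip_right.add)

definition orthonormal :: "'a set \<Rightarrow> bool" where
  "orthonormal W \<longleftrightarrow> (\<forall>v\<in>W. \<forall>w\<in>W. ip v w = (if v = w then 1 else 0))"

text \<open>For finite orthonormal \<open>W\<close>, membership in the span of \<open>W\<close> is expressed throughout
  as \<open>proj W z = z\<close>.\<close>

definition proj :: "'a set \<Rightarrow> 'a \<Rightarrow> 'a" where
  "proj W z = (\<Sum>w\<in>W. smul (ip z w) w)"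

lemma proj_add: "proj W (y + z) = proj W y + proj W z"
  by (simp add: proj_def ip_left.add smul_left.add sum.distrib)

lemma proj_diff: "proj W (y - z) = proj W y - proj W z"
  by (simp add: proj_def ip_left.diff smul_left.diff sum_subtractf)

lemma proj_smul: "proj W (smul a z) = smul a (proj W z)"
  by (simp add: proj_def smul_right.sum)

lemma proj_eq_0: "(\<And>w. w \<in> W \<Longrightarrow> ip z w = 0) \<Longrightarrow> proj W z = 0"
  by (simp add: proj_def)

lemma ip_sum_orthonormal:
  assumes "finite I" "j \<in> I" "\<And>i. i \<in> I \<Longrightarrow> ip (u i) (u j) = (if i = j then 1 else 0)"
  shows "ip (\<Sum>i\<in>I. smul (c i) (u i)) (u j) = c j"
proof -
  have "ip (\<Sum>i\<in>I. smul (c i) (u i)) (u j) = (\<Sum>i\<in>I. if i = j then c i else 0)"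
    unfolding ip_left.sum using assms by (intro sum.cong) auto
  then show ?thesis
    using assms by simp
qed

lemma norm_sum_orthonormal:
  assumes "finite I" "\<And>i j. i \<in> I \<Longrightarrow> j \<in> I \<Longrightarrow> ip (u i) (u j) = (if i = j then 1 else 0)"
  shows "(norm (\<Sum>i\<in>I. smul (c i) (u i)))\<^sup>2 = (\<Sum>i\<in>I. (cmod (c i))\<^sup>2)"
proof -
  let ?z = "\<Sum>i\<in>I. smul (c i) (u i)"
  have c: "ip ?z (u i) = c i" if "i \<in> I" for i
    using assms that by (intro ip_sum_orthonormal) auto
  have "ip ?z ?z = (\<Sum>i\<in>I. cnj (c i) * ip ?z (u i))"
    by (simp add: ip_right.sum)
  also have "\<dots> = (\<Sum>i\<in>I. complex_of_real ((cmod (c i))\<^sup>2))"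
    by (rule sum.cong) (simp_all only: c complex_norm_square mult.commute)
  finally show ?thesis
    by (simp add: norm_power2_eq_Re_ip)
qed

context
  fixes W :: "'a set"
  assumes W: "finite W" "orthonormal W"
begin

lemma ip_proj: "v \<in> W \<Longrightarrow> ip (proj W z) v = ip z v"
  using W ip_sum_orthonormal[of W v "\<lambda>w. w"] by (simp add: proj_def orthonormal_def)

lemma proj_proj: "proj W (proj W z) = proj W z"
  unfolding proj_def[of W "proj W z"] by (simp add: ip_proj) (simp add: proj_def)

lemma norm_proj: "(norm (proj W z))\<^sup>2 = (\<Sum>w\<in>W. (cmod (ip z w))\<^sup>2)"
  using W norm_sum_orthonormal[of W "\<lambda>w. w"] by (simp add: proj_def orthonormal_def)

lemma ip_diff_proj: "v \<in> W \<Longrightarrow> ip (z - proj W z) v = 0"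
  by (simp add: ip_left.diff ip_proj)

lemma ip_proj_orthogonal:
  assumes "\<And>w. w \<in> W \<Longrightarrow> ip u w = 0"
  shows "ip (proj W z) u = 0"
proof -
  have "ip w u = 0" if "w \<in> W" for w
    using assms[OF that] ip_commute[of w u] by simp
  then show ?thesis
    by (simp add: proj_def ip_left.sum)
qed

lemma bessel: "(\<Sum>w\<in>W. (cmod (ip z w))\<^sup>2) \<le> (norm z)\<^sup>2"
proof -
  have "ip (proj W z) (z - proj W z) = 0"
    by (rule ip_proj_orthogonal) (rule ip_diff_proj)
  from norm_add_orthogonal[OF this] show ?thesis
    by (simp add: norm_proj)
qed

lemma norm_proj_le: "norm (proj W z) \<le> norm z"
  using bessel[of z] norm_proj[of z] by (metis norm_ge_zero power2_le_imp_le)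

text \<open>One Gram-Schmidt step: \<open>u\<close> is the normalised residual
  \<open>f - proj W f\<close>. The last conclusion places \<open>f\<close> in the span of
  \<open>insert u W\<close>.\<close>

lemma orthonormal_extend:
  assumes "proj W f \<noteq> f"
  obtains u where "u \<notin> W" "\<And>w. w \<in> W \<Longrightarrow> ip u w = 0"
    "orthonormal (insert u W)" "f = proj W f + smul (ip f u) u"
proof -
  define r where "r = norm (f - proj W f)"
  define u where "u = smul (complex_of_real (1 / r)) (f - proj W f)"
  have r: "r > 0"
    using assms by (simp add: r_def)
  have norm_u: "norm u = 1"
    using r by (simp add: u_def norm_smul norm_divide) (simp add: r_def)
  have orth: "ip u w = 0" if "w \<in> W" for w
    using that by (simp add: u_def ip_diff_proj)
  have orth': "ip w u = 0" if "w \<in> W" for w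
    using orth[OF that] ip_commute[of u w] by simp
  have "u \<notin> W"
    using norm_u orth[of u] by (auto simp: ip_self)
  have "orthonormal (insert u W)"
    using W(2) norm_u orth orth' \<open>u \<notin> W\<close>
    unfolding orthonormal_def by (auto simp: ip_self)
  have ru: "f = proj W f + smul (complex_of_real r) u"
    using r by (simp add: u_def)
  have "ip f u = complex_of_real r"
    using norm_u by (subst ru) (simp add: ip_left.add ip_self ip_proj_orthogonal orth)
  then have "f = proj W f + smul (ip f u) u"
    using ru by metis
  then show ?thesis
    by (intro that[of u] orth \<open>u \<notin> W\<close> \<open>orthonormal (insert u W)\<close>)
qed

end

text \<open>Bessel's inequality for the single unit vector in the direction of
  \<open>y\<close>.\<close>

lemma cauchy_schwarz: "cmod (ip x y) \<le> norm x * norm y"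
proof (cases "y = 0")
  case False
  define u where "u = smul (complex_of_real (1 / norm y)) y"
  have y: "y = smul (complex_of_real (norm y)) u"
    using False by (simp add: u_def)
  have "norm u = 1"
    using False by (simp add: u_def norm_smul norm_divide)
  then have "orthonormal {u}"
    by (simp add: orthonormal_def ip_self)
  from bessel[OF _ this, of x] have "cmod (ip x u) \<le> norm x"
    by (simp add: power2_le_iff_abs_le)
  then have "cmod (ip x u) * norm y \<le> norm x * norm y"
    by (simp add: mult_right_mono)
  then show ?thesis
    by (subst y) (simp add: norm_mult mult.commute)
qed simp

lemma exists_orthonormal_containing:
  assumes "finite F"
  shows "\<exists>W. finite W \<and> orthonormal W \<and> (\<forall>f\<in>F. proj W f = f)"
  using assms
proof (induction F rule: finite_induct)
  case empty
  then show ?case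
    by (auto simp: orthonormal_def)
next
  case (insert f F)
  then obtain W where W: "finite W" "orthonormal W" and F: "\<And>g. g \<in> F \<Longrightarrow> proj W g = g"
    by blast
  show ?case
  proof (cases "proj W f = f")
    case True
    then show ?thesis
      using W F by blast
  next
    case False
    obtain u where u: "u \<notin> W" "\<And>w. w \<in> W \<Longrightarrow> ip u w = 0"
      "orthonormal (insert u W)" "f = proj W f + smul (ip f u) u"
      using orthonormal_extend[OF W False] by metis
    have P: "proj (insert u W) g = proj W g + smul (ip g u) u" for g
      using W u(1) by (simp add: proj_def add.commute)
    have "proj (insert u W) g = g" if "g \<in> F" for g
      using ip_proj_orthogonal[OF W u(2), of g] F[OF that] by (simp add: P)
    then show ?thesis
      using W u(3) P[of f] u(4)[symmetric] by (intro exI[of _ "insert u W"]) auto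
  qed
qed

text \<open>A finite set never spans the space, so some vector differs from its projection and
  \<open>orthonormal_extend\<close> yields one more direction. This supplies room for the shift
  attached to \<open>W\<close>.\<close>

lemma exists_orthonormal_family:
  assumes "complex_infinite_dimensional smul" "finite W" "orthonormal W"
  shows "\<exists>u::nat \<Rightarrow> 'a. inj_on u {..<n} \<and> u ` {..<n} \<inter> W = {} \<and> orthonormal (W \<union> u ` {..<n})"
proof (induction n)
  case 0
  then show ?case
    using assms by simp
next
  case (Suc n)
  then obtain u :: "nat \<Rightarrow> 'a" where u: "inj_on u {..<n}" "u ` {..<n} \<inter> W = {}"
    "orthonormal (W \<union> u ` {..<n})"
    by blast
  let ?W = "W \<union> u ` {..<n}"
  have fin: "finite ?W"
    using assms by simp
  then have "complex_span smul ?W \<noteq> UNIV"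
    using assms(1) unfolding complex_infinite_dimensional_def by blast
  then obtain z where z: "z \<notin> complex_span smul ?W"
    by blast
  have "proj ?W z \<in> complex_span smul ?W"
    unfolding complex_span_def proj_def using fin by blast
  with z have "proj ?W z \<noteq> z"
    by metis
  then obtain v where v: "v \<notin> ?W" "orthonormal (insert v ?W)"
    using orthonormal_extend[OF fin u(3)] by metis
  have im: "u(n := v) ` {..<Suc n} = insert v (u ` {..<n})"
    by (auto simp: lessThan_Suc image_iff)
  have "inj_on (u(n := v)) {..<Suc n}"
    using u(1) v(1) by (auto simp: lessThan_Suc inj_on_def)
  moreover have "u(n := v) ` {..<Suc n} \<inter> W = {}"
    using u(2) v(1) im by auto
  moreover have "orthonormal (W \<union> u(n := v) ` {..<Suc n})"
    using v(2) im by simp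
  ultimately show ?case
    by blast
qed

subsection \<open>Approximation by operators with prescribed orbits\<close>

text \<open>The norm bound is pointwise, so that membership passes to pointwise limits. For
  \<open>0 \<le> r\<close> this is the ball given by \<open>onorm\<close>.\<close>

definition operator_ball :: "real \<Rightarrow> ('a \<Rightarrow> 'a) set" where
  "operator_ball r = {T. (\<forall>x y. T (x + y) = T x + T y) \<and> (\<forall>a x. T (smul a x) = smul a (T x)) \<and>
     (\<forall>x. norm (T x) \<le> r * norm x)}"

lemma operator_ballI:
  assumes "\<And>x y. T (x + y) = T x + T y" "\<And>a x. T (smul a x) = smul a (T x)"
    "\<And>x. norm (T x) \<le> r * norm x"
  shows "T \<in> operator_ball r"
  using assms by (simp add: operator_ball_def)

lemma operator_ballD:
  assumes "T \<in> operator_ball r"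
  shows "T (x + y) = T x + T y" "T (smul a x) = smul a (T x)" "norm (T x) \<le> r * norm x"
  using assms by (auto simp: operator_ball_def)

lemma operator_ball_diff: "T \<in> operator_ball r \<Longrightarrow> T (x - y) = T x - T y"
  using operator_ballD(1)[of T r "x - y" y] by simp

lemma funpow_operator_ball:
  assumes "T \<in> operator_ball r"
  shows "(T ^^ n) (x + smul a y) = (T ^^ n) x + smul a ((T ^^ n) y)"
  by (induction n) (simp_all add: operator_ballD[OF assms])

lemma bounded_complex_linear_onorm_eq:
  assumes "0 \<le> r"
  shows "{T. bounded_complex_linear smul T \<and> onorm T \<le> r} = operator_ball r"
proof (intro set_eqI iffI)
  fix T assume T: "T \<in> {T. bounded_complex_linear smul T \<and> onorm T \<le> r}"
  then have lin: "T (x + y) = T x + T y" "T (smul a x) = smul a (T x)" for x y a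
    by (auto simp: bounded_complex_linear_def)
  obtain K where K: "norm (T x) \<le> K * norm x" for x
    using T by (auto simp: bounded_complex_linear_def)
  have bl: "bounded_linear T"
    by (rule bounded_linear_intro[where K = K])
      (use lin K in \<open>simp_all add: mult.commute flip: smul_of_real\<close>)
  have "norm (T x) \<le> r * norm x" for x
    using onorm[OF bl, of x] T mult_right_mono[of "onorm T" r "norm x"] by auto
  then show "T \<in> operator_ball r"
    using lin by (intro operator_ballI)
next
  fix T assume T: "T \<in> operator_ball r"
  then show "T \<in> {T. bounded_complex_linear smul T \<and> onorm T \<le> r}"
    using onorm_bound[OF assms, of T]
    by (auto simp: operator_ball_def bounded_complex_linear_def)
qed

text \<open>The size \<open>c\<close> of the perturbation of \<open>x\<close> is fixed before the
  time \<open>n\<close>: a small \<open>c\<close> is paid for by a longer shift. The bound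
  \<open>s\<close> may lie strictly below a given radius, which leaves room for a later
  conjugation.\<close>

lemma exists_transitive_dilation:
  assumes inf: "complex_infinite_dimensional smul" and W: "finite W" "orthonormal W"
    and T0: "T0 \<in> operator_ball r" and \<theta>: "0 \<le> \<theta>" "0 \<le> r" "\<theta> * r < s" "1 < s"
    and x: "proj W x = x" and y: "proj W y = y" and c: "0 < c"
  obtains T n u where "T \<in> operator_ball s" "norm u = 1" "\<And>w. w \<in> W \<Longrightarrow> ip u w = 0"
    "\<And>f. proj W f = f \<Longrightarrow> proj W (T0 f) = T0 f \<Longrightarrow> T f = \<theta> *\<^sub>R T0 f"
    "(T ^^ n) (x + smul (complex_of_real c) u) = y"
proof -
  define \<rho> where "\<rho> = \<theta> * r"
  have \<rho>: "0 \<le> \<rho>" "\<rho> < s"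
    using \<theta> by (auto simp: \<rho>_def)
  \<comment> \<open>Chosen so that the vector (\<rho>, \<eta>) has length \<open>s\<close>. Hence
    \<open>A\<close> and the entry of the shift into the span of \<open>W\<close> together have norm
    at most \<open>s\<close>.\<close>
  define \<eta> where "\<eta> = sqrt (s\<^sup>2 - \<rho>\<^sup>2)"
  have "\<rho>\<^sup>2 < s\<^sup>2"
    using \<rho> by (intro power_strict_mono) auto
  then have \<eta>: "0 < \<eta>" "\<rho>\<^sup>2 + \<eta>\<^sup>2 = s\<^sup>2"
    by (auto simp: \<eta>_def)
  define A where "A z = smul (complex_of_real \<theta>) (proj W (T0 (proj W z)))" for z
  have A_add: "A (y + z) = A y + A z" and A_smul: "A (smul a z) = smul a (A z)"
    and proj_A: "proj W (A z) = A z" for y z a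
    by (simp_all add: A_def proj_add proj_smul proj_proj[OF W] operator_ballD[OF T0] smul_add_right
        mult.commute)
  have norm_A: "norm (A z) \<le> \<rho> * norm (proj W z)" for z
  proof -
    have "norm (A z) \<le> \<theta> * norm (T0 (proj W z))"
      using \<theta> norm_proj_le[OF W] by (simp add: A_def norm_smul mult_left_mono)
    also have "\<dots> \<le> \<theta> * (r * norm (proj W z))"
      using \<theta> by (intro mult_left_mono operator_ballD(3)[OF T0]) auto
    finally show ?thesis
      by (simp add: \<rho>_def mult.assoc)
  qed
  have proj_Ak: "proj W ((A ^^ k) x) = (A ^^ k) x" for k
    using x proj_A by (cases k) simp_all
  have norm_Ak: "norm ((A ^^ k) x) \<le> \<rho> ^ k * norm x" for k
  proof (induction k)
    case (Suc k)
    have "norm ((A ^^ Suc k) x) \<le> \<rho> * norm ((A ^^ k) x)"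
      using norm_A[of "(A ^^ k) x"] proj_Ak by simp
    also have "\<dots> \<le> \<rho> * (\<rho> ^ k * norm x)"
      using Suc \<rho> by (intro mult_left_mono)
    finally show ?case
      by (simp add: mult.assoc)
  qed simp
  \<comment> \<open>After division by \<open>s ^ n\<close> the left side tends to 0, because
    \<open>s\<close> exceeds both 1 and \<rho>, while the right side stays at
    \<open>c * \<eta>\<close>.\<close>
  obtain n where n: "norm y + \<rho> ^ Suc n * norm x \<le> c * s ^ n * \<eta>"
  proof -
    have "(\<lambda>n. norm y * (1 / s) ^ n + \<rho> * norm x * (\<rho> / s) ^ n)
        \<longlonglongrightarrow> norm y * 0 + \<rho> * norm x * 0"
      using \<rho> \<theta> by (intro tendsto_intros LIMSEQ_power_zero) auto
    then have "\<forall>\<^sub>F n in sequentially. norm y * (1 / s) ^ n + \<rho> * norm x * (\<rho> / s) ^ n < c * \<eta>"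
      using c \<eta> by (intro order_tendstoD(2)) auto
    then obtain n where "norm y * (1 / s) ^ n + \<rho> * norm x * (\<rho> / s) ^ n < c * \<eta>"
      unfolding eventually_sequentially by blast
    then have "(norm y * (1 / s) ^ n + \<rho> * norm x * (\<rho> / s) ^ n) * s ^ n \<le> (c * \<eta>) * s ^ n"
      using \<theta> by (intro mult_right_mono) auto
    moreover have "(norm y * (1 / s) ^ n + \<rho> * norm x * (\<rho> / s) ^ n) * s ^ n
        = norm y + \<rho> ^ Suc n * norm x"
      using \<theta> by (simp add: power_divide distrib_right)
    ultimately have "norm y + \<rho> ^ Suc n * norm x \<le> c * s ^ n * \<eta>"
      by (simp add: mult_ac)
    then show ?thesis
      using that by blast
  qed
  obtain u :: "nat \<Rightarrow> 'a" where u: "inj_on u {..<Suc n}" "u ` {..<Suc n} \<inter> W = {}"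
    "orthonormal (W \<union> u ` {..<Suc n})"
    using exists_orthonormal_family[OF inf W] by blast
  have uu: "ip (u i) (u j) = (if i = j then 1 else 0)" if "i < Suc n" "j < Suc n" for i j
    using u(1,3) that unfolding orthonormal_def inj_on_def by auto
  have uW: "ip (u i) w = 0" if "i < Suc n" "w \<in> W" for i w
    using u(2,3) that unfolding orthonormal_def by fastforce
  have proj_u: "proj W (u i) = 0" if "i < Suc n" for i
    using that by (intro proj_eq_0 uW)
  have Eu: "ip z (u i) = 0" if "i < Suc n" "proj W z = z" for z i
    using ip_proj_orthogonal[OF W, of "u i" z] uW that by auto
  define d where "d = c * s ^ n * \<eta>"
  have d: "0 < d"
    using c \<theta> \<eta> by (simp add: d_def)
  \<comment> \<open>The solution of \<open>(A ^^ Suc n) x + d v = y\<close>; the choice of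
    \<open>n\<close> puts it in the unit ball.\<close>
  define v where "v = smul (complex_of_real (1 / d)) (y - (A ^^ Suc n) x)"
  have proj_v: "proj W v = v"
    unfolding v_def proj_smul proj_diff y proj_Ak ..
  have "norm (y - (A ^^ Suc n) x) \<le> d"
    using norm_triangle_ineq4[of y "(A ^^ Suc n) x"] norm_Ak[of "Suc n"] n
    unfolding d_def by linarith
  then have norm_v: "norm v \<le> 1"
    using d by (simp add: v_def norm_smul norm_divide)
  \<comment> \<open>The operator \<open>A\<close> on the span of \<open>W\<close>, the weighted
    shift from \<open>u (Suc k)\<close> to \<open>s\<close> times \<open>u k\<close>, and the link
    from \<open>u 0\<close> to \<eta> times \<open>v\<close>; everything orthogonal to these vectors
    is sent to 0.\<close>
  define T where "T z = A z + smul (\<eta> * ip z (u 0)) v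
      + (\<Sum>k<n. smul (s * ip z (u (Suc k))) (u k))" for z
  have T: "T \<in> operator_ball s"
  proof (rule operator_ballI)
    fix z
    define a where "a = norm (proj W z)"
    define b where "b = cmod (ip z (u 0))"
    \<comment> \<open>The value \<open>T z\<close> splits into \<open>p\<close> in the span of
      \<open>W\<close> and \<open>q\<close> in the span of the \<open>u k\<close>; these are
      orthogonal, so Pythagoras applies.\<close>
    define p where "p = A z + smul (\<eta> * ip z (u 0)) v"
    define q where "q = (\<Sum>k<n. smul (s * ip z (u (Suc k))) (u k))"
    have "proj W p = p"
      by (simp add: p_def proj_add proj_smul proj_A proj_v)
    then have "ip p q = 0"
      by (simp add: q_def ip_right.sum Eu)
    then have "(norm (T z))\<^sup>2 = (norm p)\<^sup>2 + (norm q)\<^sup>2"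
      using norm_add_orthogonal[of p q] by (simp add: T_def p_def q_def)
    also have "(norm q)\<^sup>2 = s\<^sup>2 * (\<Sum>k<n. (cmod (ip z (u (Suc k))))\<^sup>2)"
      unfolding q_def
      by (subst norm_sum_orthonormal)
        (auto simp: uu norm_mult power_mult_distrib sum_distrib_left)
    also have "(norm p)\<^sup>2 \<le> s\<^sup>2 * (a\<^sup>2 + b\<^sup>2)"
    proof -
      have "norm (smul (\<eta> * ip z (u 0)) v) \<le> \<eta> * b"
        using norm_v \<eta> by (simp add: norm_smul norm_mult b_def mult_left_le)
      then have "norm p \<le> \<rho> * a + \<eta> * b"
        using norm_triangle_ineq[of "A z" "smul (\<eta> * ip z (u 0)) v"] norm_A[of z]
        by (simp add: p_def a_def)
      then have "(norm p)\<^sup>2 \<le> (\<rho> * a + \<eta> * b)\<^sup>2"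
        by (intro power_mono) auto
      \<comment> \<open>Lagrange's identity: the added square completes the product of the two sums
        of squares, as in Cauchy-Schwarz.\<close>
      also have "\<dots> \<le> (\<rho> * a + \<eta> * b)\<^sup>2 + (\<rho> * b - \<eta> * a)\<^sup>2"
        by simp
      also have "\<dots> = (\<rho>\<^sup>2 + \<eta>\<^sup>2) * (a\<^sup>2 + b\<^sup>2)"
        by (simp add: power2_eq_square algebra_simps)
      finally show ?thesis
        using \<eta> by simp
    qed
    finally have "(norm (T z))\<^sup>2 \<le> s\<^sup>2 * (a\<^sup>2 + (b\<^sup>2 + (\<Sum>k<n. (cmod (ip z (u (Suc k))))\<^sup>2)))"
      by (simp add: algebra_simps)
    also have "b\<^sup>2 + (\<Sum>k<n. (cmod (ip z (u (Suc k))))\<^sup>2) = (\<Sum>w\<in>u ` {..<Suc n}. (cmod (ip z w))\<^sup>2)"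
      unfolding sum.reindex[OF u(1)] b_def by (simp add: sum.lessThan_Suc_shift del: sum.lessThan_Suc)
    also have "a\<^sup>2 + \<dots> = (\<Sum>w\<in>W \<union> u ` {..<Suc n}. (cmod (ip z w))\<^sup>2)"
      unfolding a_def norm_proj[OF W] using W u(2) by (intro sum.union_disjoint[symmetric]) auto
    also have "s\<^sup>2 * \<dots> \<le> s\<^sup>2 * (norm z)\<^sup>2"
      using W u(3) by (intro mult_left_mono bessel) auto
    finally have "(norm (T z))\<^sup>2 \<le> (s * norm z)\<^sup>2"
      by (simp add: power_mult_distrib)
    then show "norm (T z) \<le> s * norm z"
      by (rule power2_le_imp_le) (use \<theta> in simp)
  qed (simp_all add: T_def A_add A_smul ip_add_left smul_add_left smul_add_right sum.distrib
      smul_right.sum algebra_simps)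
  have T_E: "T z = A z" if "proj W z = z" for z
    using that by (simp add: T_def Eu)
  have Tk_x: "(T ^^ k) x = (A ^^ k) x" for k
    by (induction k) (simp_all add: T_E proj_Ak)
  have Tu0: "T (u 0) = smul (complex_of_real \<eta>) v"
    \<comment> \<open>The instance at zero yields \<open>T0 0 = 0\<close>, so \<open>A\<close>
      vanishes on vectors orthogonal to \<open>W\<close>.\<close>
    using operator_ballD(2)[OF T0, of 0 0] by (simp add: T_def A_def proj_u proj_eq_0 uu)
  have Tu: "T (u (Suc i)) = smul (complex_of_real s) (u i)" if "i < n" for i
  proof -
    have "(\<Sum>k<n. smul (s * ip (u (Suc i)) (u (Suc k))) (u k))
        = (\<Sum>k<n. if k = i then smul (complex_of_real s) (u k) else 0)"
      using that by (intro sum.cong) (auto simp: uu)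
    then show ?thesis
      using that operator_ballD(2)[OF T0, of 0 0] by (simp add: T_def A_def proj_u proj_eq_0 uu)
  qed
  have "(T ^^ k) (u n) = smul (complex_of_real (s ^ k)) (u (n - k))" if "k \<le> n" for k
    using that
  proof (induction k)
    case (Suc k)
    then have "n - k = Suc (n - Suc k)"
      by simp
    with Suc show ?case
      using Tu[of "n - Suc k"] by (simp add: operator_ballD(2)[OF T] mult.commute)
  qed simp
  \<comment> \<open>The shift takes \<open>n\<close> steps down to \<open>u 0\<close>; one further
    step enters the span of \<open>W\<close>, hence the exponent \<open>Suc n\<close>.\<close>
  from this[of n] have "(T ^^ Suc n) (u n) = smul (complex_of_real (s ^ n * \<eta>)) v"
    by (simp add: operator_ballD(2)[OF T] Tu0)
  then have "(T ^^ Suc n) (x + smul (complex_of_real c) (u n))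
      = (A ^^ Suc n) x + smul (complex_of_real d) v"
    unfolding funpow_operator_ball[OF T] Tk_x by (simp add: d_def mult.assoc)
  also have "\<dots> = y"
    using d by (simp add: v_def)
  finally have reach: "(T ^^ Suc n) (x + smul (complex_of_real c) (u n)) = y" .
  show ?thesis
  proof (rule that[OF T])
    show "norm (u n) = 1"
      using uu[of n n] by (simp add: norm_eq_sqrt_ip)
    show "ip (u n) w = 0" if "w \<in> W" for w
      using uW that by simp
    show "T f = \<theta> *\<^sub>R T0 f" if "proj W f = f" "proj W (T0 f) = T0 f" for f
      using that by (simp add: T_E A_def smul_of_real)
  qed (rule reach)
qed

text \<open>The dilation \<open>T\<close> steers \<open>x + c u\<close> to \<open>y\<close>, not
  \<open>x\<close> itself. With \<open>L\<close> near the identity, \<open>L x = x + c u\<close> and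
  inverse \<open>K\<close>, the conjugate \<open>S = K T L\<close> steers \<open>x\<close> to
  \<open>K y\<close>, which is near \<open>y\<close>.\<close>

lemma operator_ball_approx_transitive:
  assumes inf: "complex_infinite_dimensional smul" and R: "1 < R"
    and T0: "T0 \<in> operator_ball R" and F: "finite F" and pos: "0 < \<delta>" "0 < \<epsilon>" and "x \<noteq> 0"
  obtains S n where "S \<in> operator_ball R" "\<And>f. f \<in> F \<Longrightarrow> norm (S f - T0 f) < \<delta>"
    "norm ((S ^^ n) x - y) < \<epsilon>"
proof -
  obtain M where M: "0 < M" "\<And>f. f \<in> F \<Longrightarrow> norm f \<le> M"
    using finite_imp_bounded[OF F] unfolding bounded_pos by blast
  \<comment> \<open>Replacing \<open>T0\<close> by \<theta> times \<open>T0\<close> costs less than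
    \<open>\<delta> / 2\<close> on \<open>F\<close>; the summand 1 in the denominator makes this
    strict, and the minimum keeps \<theta> nonnegative.\<close>
  define \<theta> where "\<theta> = 1 - min (1 / 2) (\<delta> / (2 * R * M + 1))"
  have "0 < R * M"
    using R M by simp
  then have "0 < \<delta> / (2 * R * M + 1)"
    using pos by simp
  then have \<theta>: "0 \<le> \<theta>" "\<theta> < 1"
    by (auto simp: \<theta>_def)
  have "1 - \<theta> \<le> \<delta> / (2 * R * M + 1)"
    by (simp add: \<theta>_def)
  then have "(1 - \<theta>) * R * M \<le> \<delta> / (2 * R * M + 1) * R * M"
    using R M by (intro mult_right_mono) auto
  also have "\<dots> < \<delta> / 2"
    using \<open>0 < R * M\<close> pos by (simp add: field_simps add_pos_pos)
  finally have \<theta>_small: "(1 - \<theta>) * R * M < \<delta> / 2" .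
  define s where "s = (max 1 (\<theta> * R) + R) / 2"
  have "\<theta> * R < R"
    using \<theta> R by simp
  then have s: "1 < s" "\<theta> * R < s" "s < R"
    using R by (auto simp: s_def max_def)
  \<comment> \<open>Three demands on the size \<open>q\<close> of the perturbation: its error on
    \<open>F\<close>, the distance from \<open>K y\<close> to \<open>y\<close>, and the norm of
    \<open>K T L\<close>. Each holds in the limit as \<open>q\<close> tends to 0.\<close>
  have lims: "((\<lambda>q. q * s * (2 + q) * M) \<longlongrightarrow> 0 * s * (2 + 0) * M) (at_right 0)"
    "((\<lambda>q. q * norm y) \<longlongrightarrow> 0 * norm y) (at_right 0)"
    "((\<lambda>q. (1 + q) * (s * (1 + q))) \<longlongrightarrow> (1 + 0) * (s * (1 + 0))) (at_right (0::real))"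
    by (intro tendsto_intros)+
  have "\<forall>\<^sub>F q in at_right 0. q * s * (2 + q) * M < \<delta> / 2"
    "\<forall>\<^sub>F q in at_right 0. q * norm y < \<epsilon>"
    "\<forall>\<^sub>F q in at_right (0::real). (1 + q) * (s * (1 + q)) < R"
    by (rule order_tendstoD(2)[OF lims(1)] order_tendstoD(2)[OF lims(2)]
        order_tendstoD(2)[OF lims(3)], use pos s in simp)+
  then have "\<forall>\<^sub>F q in at_right (0::real). 0 < q \<and> q * s * (2 + q) * M < \<delta> / 2 \<and> q * norm y < \<epsilon> \<and>
      (1 + q) * (s * (1 + q)) < R"
    using eventually_at_right_less[of "0::real"] by eventually_elim auto
  then obtain q where q: "0 < q" "q * s * (2 + q) * M < \<delta> / 2" "q * norm y < \<epsilon>"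
    "(1 + q) * (s * (1 + q)) < R"
    using eventually_happens[of _ "at_right (0::real)"] trivial_limit_at_right_real by blast
  define c where "c = q * norm x"
  have c: "0 < c"
    using q \<open>x \<noteq> 0\<close> by (simp add: c_def)
  obtain W where W: "finite W" "orthonormal W"
    and WF: "\<And>f. f \<in> insert x (insert y (F \<union> T0 ` F)) \<Longrightarrow> proj W f = f"
    using exists_orthonormal_containing[of "insert x (insert y (F \<union> T0 ` F))"] F by blast
  obtain T n u where T: "T \<in> operator_ball s" and u: "norm u = 1" "\<And>w. w \<in> W \<Longrightarrow> ip u w = 0"
    and TF: "\<And>f. proj W f = f \<Longrightarrow> proj W (T0 f) = T0 f \<Longrightarrow> T f = \<theta> *\<^sub>R T0 f"
    and reach: "(T ^^ n) (x + smul (complex_of_real c) u) = y"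
    by (rule exists_transitive_dilation[OF inf W T0 \<theta>(1) _ s(2,1) _ _ c, of x y]) (use WF R in auto)
  have "ip x u = 0"
    using ip_proj_orthogonal[OF W u(2), of x] WF by simp
  then have ux: "ip u x = 0"
    using ip_commute[of x u] by simp
  \<comment> \<open>The multiple of the functional \<open>ip _ x\<close> with
    \<open>g x = c\<close>. Since \<open>u\<close> is orthogonal to \<open>x\<close>, also
    \<open>g u = 0\<close>; the rank-one map \<open>z \<mapsto> smul (g z) u\<close> thus squares to
    zero, and \<open>K\<close> inverts \<open>L\<close>. The choice of \<open>c\<close> bounds its
    norm by \<open>q\<close>.\<close>
  define g where "g z = complex_of_real (c / (norm x)\<^sup>2) * ip z x" for z
  define L where "L z = z + smul (g z) u" for z
  define K where "K z = z - smul (g z) u" for z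
  have g_lin: "g (z + z') = g z + g z'" "g (z - z') = g z - g z'" "g (smul a z) = a * g z" "g u = 0"
    for z z' a
    by (simp_all add: g_def ip_left.add ip_left.diff ux algebra_simps add_divide_distrib
        diff_divide_distrib)
  have norm_g: "norm (smul (g z) u) \<le> q * norm z" for z
  proof -
    have "norm (smul (g z) u) = c / (norm x)\<^sup>2 * cmod (ip z x)"
      using u c by (simp add: norm_smul g_def norm_mult norm_divide norm_power)
    also have "\<dots> \<le> c / (norm x)\<^sup>2 * (norm z * norm x)"
      using c by (intro mult_left_mono cauchy_schwarz) auto
    also have "\<dots> = q * norm z"
      using \<open>x \<noteq> 0\<close> by (simp add: c_def power2_eq_square)
    finally show ?thesis .
  qed
  have LK: "L (K z) = z" for z
    by (simp add: L_def K_def g_lin)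
  have norm_L: "norm (L z) \<le> (1 + q) * norm z" and norm_K: "norm (K z) \<le> (1 + q) * norm z" for z
    using norm_triangle_ineq[of z "smul (g z) u"] norm_triangle_ineq4[of z "smul (g z) u"] norm_g[of z]
    by (auto simp: L_def K_def algebra_simps)
  define S where "S z = K (T (L z))" for z
  have S: "S \<in> operator_ball R"
  proof (rule operator_ballI)
    show "S (z + z') = S z + S z'" for z z'
      by (simp add: S_def K_def L_def g_lin operator_ballD[OF T] smul_left.add algebra_simps)
    show "S (smul a z) = smul a (S z)" for a z
      by (simp add: S_def K_def L_def g_lin operator_ballD[OF T] smul_right.add smul_right.diff
          smul_left.add algebra_simps)
    fix z
    have "norm (S z) \<le> (1 + q) * (s * ((1 + q) * norm z))"
      unfolding S_def using s q
      by (intro order_trans[OF norm_K] mult_left_mono order_trans[OF operator_ballD(3)[OF T]]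
          norm_L) auto
    also have "\<dots> \<le> R * norm z"
      using mult_right_mono[OF less_imp_le[OF q(4)], of "norm z"] by (simp add: mult.assoc)
    finally show "norm (S z) \<le> R * norm z" .
  qed
  have "norm (S f - T0 f) < \<delta>" if f: "f \<in> F" for f
  proof -
    have Tf: "T f = \<theta> *\<^sub>R T0 f"
      using TF WF f by simp
    have "T (L f) = T f + smul (g f) (T u)"
      by (simp add: L_def operator_ballD[OF T])
    \<comment> \<open>Three errors: the perturbation inside \<open>T\<close>, the one outside, and
      the factor \<theta>.\<close>
    then have S_eq: "S f - T0 f = smul (g f) (T u) - smul (g (T (L f))) u - (1 - \<theta>) *\<^sub>R T0 f"
      by (simp add: S_def K_def Tf algebra_simps)
    have "norm (T (L f)) \<le> s * ((1 + q) * norm f)"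
      using s by (intro order_trans[OF operator_ballD(3)[OF T]] mult_left_mono norm_L) auto
    then have "norm (smul (g (T (L f))) u) \<le> q * (s * ((1 + q) * norm f))"
      using q by (intro order_trans[OF norm_g] mult_left_mono) auto
    moreover have "norm (smul (g f) (T u)) \<le> s * (q * norm f)"
      using s operator_ballD(3)[OF T, of "smul (g f) u"]
      by (intro order_trans[OF _ mult_left_mono[OF norm_g]]) (auto simp: operator_ballD(2)[OF T])
    moreover have "norm ((1 - \<theta>) *\<^sub>R T0 f) \<le> (1 - \<theta>) * (R * norm f)"
      using \<theta> operator_ballD(3)[OF T0, of f] by (simp add: mult_left_mono)
    ultimately have "norm (S f - T0 f) \<le> q * s * (2 + q) * norm f + (1 - \<theta>) * R * norm f"
      unfolding S_eq
      using norm_triangle_ineq4[of "smul (g f) (T u) - smul (g (T (L f))) u" "(1 - \<theta>) *\<^sub>R T0 f"]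
        norm_triangle_ineq4[of "smul (g f) (T u)" "smul (g (T (L f))) u"]
      by (simp add: algebra_simps)
    also have "\<dots> \<le> q * s * (2 + q) * M + (1 - \<theta>) * R * M"
      using q s \<theta> R M(2)[OF f] by (intro add_mono mult_left_mono) auto
    also have "\<dots> < \<delta>"
      using q \<theta>_small by simp
    finally show ?thesis .
  qed
  moreover have "norm ((S ^^ n) x - y) < \<epsilon>"
  proof -
    have Lx: "L x = x + smul (complex_of_real c) u"
      using \<open>x \<noteq> 0\<close> by (simp add: L_def g_def ip_self)
    have "L ((S ^^ k) z) = (T ^^ k) (L z)" for k z
      by (induction k) (simp_all add: S_def LK)
    then have "L ((S ^^ n) x) = y"
      by (simp add: Lx reach)
    moreover have "K (L z) = z" for z
      by (simp add: L_def K_def g_lin)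
    ultimately have "(S ^^ n) x = K y"
      by metis
    then have "norm ((S ^^ n) x - y) \<le> q * norm y"
      using norm_g[of y] by (simp add: K_def)
    then show ?thesis
      using q by simp
  qed
  ultimately show ?thesis
    using that S by blast
qed

subsection \<open>The strong operator topology on balls of operators\<close>

lemma operator_ball_dist:
  assumes "T \<in> operator_ball r"
  shows "dist (T x) (T y) \<le> r * dist x y"
  using operator_ballD(3)[OF assms, of "x - y"] by (simp add: dist_norm operator_ball_diff[OF assms])

text \<open>Induction on \<open>n\<close>: split \<open>S ((S ^^ n) x)\<close> into
  \<open>S ((T ^^ n) x)\<close>, which is evaluation at a fixed point, and a remainder controlled by
  the Lipschitz constant \<open>r\<close> common to the whole ball.\<close>

lemma continuous_on_funpow_apply: "continuous_on (operator_ball r) (\<lambda>T. (T ^^ n) x)"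
proof (induction n)
  case (Suc n)
  show ?case
    unfolding continuous_on_def
  proof
    fix T assume T: "T \<in> operator_ball r"
    let ?F = "at T within operator_ball r"
    have IH: "((\<lambda>S. (S ^^ n) x) \<longlongrightarrow> (T ^^ n) x) ?F"
      using Suc T by (simp add: continuous_on_def)
    have "continuous_on (operator_ball r) (\<lambda>S. S ((T ^^ n) x))"
      by (rule continuous_on_subset[OF continuous_on_product_coordinates]) simp
    then have "((\<lambda>S. S ((T ^^ n) x)) \<longlongrightarrow> T ((T ^^ n) x)) ?F"
      using T by (simp add: continuous_on_def)
    moreover have "((\<lambda>S. S ((S ^^ n) x) - S ((T ^^ n) x)) \<longlongrightarrow> 0) ?F"
    proof (rule Lim_null_comparison)
      show "\<forall>\<^sub>F S in ?F. norm (S ((S ^^ n) x) - S ((T ^^ n) x)) \<le> r * dist ((S ^^ n) x) ((T ^^ n) x)"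
        using operator_ball_dist by (simp add: eventually_at_filter dist_norm)
      show "((\<lambda>S. r * dist ((S ^^ n) x) ((T ^^ n) x)) \<longlongrightarrow> 0) ?F"
        using IH by (intro tendsto_mult_right_zero) (simp add: tendsto_dist_iff[symmetric])
    qed
    ultimately show "((\<lambda>S. (S ^^ Suc n) x) \<longlongrightarrow> (T ^^ Suc n) x) ?F"
      using tendsto_add by fastforce
  qed
qed simp

lemma openin_orbit_meets:
  assumes "open U"
  shows "openin (top_of_set (operator_ball r)) {T \<in> operator_ball r. \<exists>n. (T ^^ n) x \<in> U}"
proof -
  have "{T \<in> operator_ball r. \<exists>n. (T ^^ n) x \<in> U}
      = (\<Union>n. operator_ball r \<inter> (\<lambda>T. (T ^^ n) x) -` U)"
    by auto
  also have "openin (top_of_set (operator_ball r)) \<dots>"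
    using assms
    by (intro openin_Union) (auto intro: continuous_openin_preimage_gen continuous_on_funpow_apply)
  finally show ?thesis .
qed

lemma dense_orbit_meets:
  assumes "complex_infinite_dimensional smul" "1 < R" "x \<noteq> 0" "0 < \<epsilon>"
  shows "top_of_set (operator_ball R) closure_of {T \<in> operator_ball R. \<exists>n. (T ^^ n) x \<in> ball y \<epsilon>}
    = operator_ball R"
proof -
  let ?X = "top_of_set (operator_ball R)"
  let ?S = "{T \<in> operator_ball R. \<exists>n. (T ^^ n) x \<in> ball y \<epsilon>}"
  have "?S \<inter> V \<noteq> {}" if V: "openin ?X V" "V \<noteq> {}" for V
  proof -
    obtain U where U: "open U" "V = operator_ball R \<inter> U"
      using V(1) unfolding openin_open by blast
    obtain T0 where T0: "T0 \<in> operator_ball R" "T0 \<in> U"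
      using V(2) U(2) by blast
    obtain F \<delta> where F: "finite F" "0 < \<delta>" "\<And>S. (\<And>f. f \<in> F \<Longrightarrow> dist (S f) (T0 f) < \<delta>) \<Longrightarrow> S \<in> U"
      using open_fun_contains_nbhd[OF U(1) T0(2)] by metis
    obtain S n where "S \<in> operator_ball R" "\<And>f. f \<in> F \<Longrightarrow> norm (S f - T0 f) < \<delta>"
      "norm ((S ^^ n) x - y) < \<epsilon>"
      using operator_ball_approx_transitive[OF assms(1,2) T0(1) F(1,2) assms(4,3)] by metis
    then have "S \<in> ?S \<inter> V"
      using F(3)[of S] U(2) by (auto simp: dist_norm norm_minus_commute)
    then show ?thesis
      by blast
  qed
  then show ?thesis
    using dense_intersects_open[of ?X ?S] by auto
qed

end

section \<open>Complete metrizability of operator balls\<close>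

locale complex_hilbert = complex_inner smul ip
  for smul :: "complex \<Rightarrow> 'a::banach \<Rightarrow> 'a" and ip
begin

text \<open>The common Lipschitz constant spreads the Cauchy property from \<open>D\<close> to every
  point; completeness gives limits, and linearity and the bound survive them.\<close>

lemma operator_ball_pointwise_limit:
  assumes T: "\<And>i. T i \<in> operator_ball r" and D: "closure D = UNIV"
    and conv: "\<And>x. x \<in> D \<Longrightarrow> convergent (\<lambda>i. T i x)"
  shows "\<exists>S\<in>operator_ball r. \<forall>x. (\<lambda>i. T i x) \<longlonglongrightarrow> S x"
proof -
  have "Cauchy (\<lambda>i. T i z)" for z
  proof (rule metric_CauchyI)
    fix e :: real assume e: "0 < e"
    have "z \<in> closure D"
      using D by simp
    moreover have "0 < e / (3 * (\<bar>r\<bar> + 1))"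
      using e by simp
    ultimately obtain x where x: "x \<in> D" "dist x z < e / (3 * (\<bar>r\<bar> + 1))"
      unfolding closure_approachable by blast
    have close: "dist (T i x) (T i z) < e / 3" for i
    proof -
      have "dist (T i x) (T i z) \<le> r * dist x z"
        by (rule operator_ball_dist[OF T])
      also have "\<dots> \<le> (\<bar>r\<bar> + 1) * dist x z"
        by (intro mult_right_mono) auto
      also have "\<dots> < e / 3"
        using x(2) by (simp add: field_simps)
      finally show ?thesis .
    qed
    have "Cauchy (\<lambda>i. T i x)"
      using conv[OF x(1)] by (rule convergent_Cauchy)
    then obtain N where N: "\<And>m n. N \<le> m \<Longrightarrow> N \<le> n \<Longrightarrow> dist (T m x) (T n x) < e / 3"
      using e metric_CauchyD[of "\<lambda>i. T i x" "e / 3"] by auto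
    have "dist (T m z) (T n z) < e" if "N \<le> m" "N \<le> n" for m n
      using N[OF that] close[of m] close[of n] dist_triangle[of "T m z" "T n z" "T m x"]
        dist_triangle[of "T m x" "T n z" "T n x"] by (simp add: dist_commute)
    then show "\<exists>N. \<forall>m\<ge>N. \<forall>n\<ge>N. dist (T m z) (T n z) < e"
      by blast
  qed
  then have "\<forall>z. \<exists>l. (\<lambda>i. T i z) \<longlonglongrightarrow> l"
    by (simp add: Cauchy_convergent_iff convergent_def)
  then obtain S where S: "\<And>z. (\<lambda>i. T i z) \<longlonglongrightarrow> S z"
    by metis
  have "S \<in> operator_ball r"
  proof (rule operator_ballI)
    show "S (x + y) = S x + S y" for x y
      using S[of "x + y"] tendsto_add[OF S[of x] S[of y]]
      by (intro LIMSEQ_unique[of "\<lambda>i. T i (x + y)"]) (simp_all add: operator_ballD(1)[OF T])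
    show "S (smul a x) = smul a (S x)" for a x
      using S[of "smul a x"] bounded_linear.tendsto[OF bounded_linear_smul S[of x], of a]
      by (intro LIMSEQ_unique[of "\<lambda>i. T i (smul a x)"]) (simp_all add: operator_ballD(2)[OF T])
    show "norm (S x) \<le> r * norm x" for x
      using tendsto_norm[OF S[of x]] operator_ballD(3)[OF T] by (intro LIMSEQ_le_const2) auto
  qed
  then show ?thesis
    using S by blast
qed

text \<open>Restriction to a countable dense set embeds the operator ball, with the strong operator
  topology, as a closed subset of a countable power of the space.\<close>

lemma completely_metrizable_operator_ball:
  assumes "countable D" and D: "closure D = (UNIV :: 'a set)"
  shows "completely_metrizable_space (top_of_set (operator_ball r))"
proof -
  let ?B = "operator_ball r"
  define d where "d = from_nat_into D"
  have "D \<noteq> {}"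
    using D by auto
  then have d: "range d = D"
    unfolding d_def using \<open>countable D\<close> by (rule range_from_nat_into)
  define \<Phi> where "\<Phi> T = (\<lambda>n. T (d n))" for T :: "'a \<Rightarrow> 'a"
  have "\<exists>n. dist (d n) z < inverse (Suc k)" for z k
    using D closure_approachable[of z D] d by force
  \<comment> \<open>For each \<open>z\<close>, indices of points of the dense set converging to
    \<open>z\<close> at a rate independent of any operator.\<close>
  then obtain \<sigma> where \<sigma>: "\<And>z k. dist (d (\<sigma> z k)) z < inverse (Suc k)"
    by metis
  define \<Psi> where "\<Psi> g = (\<lambda>z. lim (\<lambda>k. g (\<sigma> z k)))" for g :: "nat \<Rightarrow> 'a"
  \<comment> \<open>Uniformity over the ball makes each coordinate of \<Psi> a uniform limit of
    coordinate evaluations, hence continuous on the image of \<Phi>.\<close>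
  have unif: "uniform_limit ?B (\<lambda>k T. T (d (\<sigma> z k))) (\<lambda>T. T z) sequentially" for z
  proof (rule uniform_limitI)
    fix e :: real assume "0 < e"
    have "(\<lambda>k. \<bar>r\<bar> * inverse (Suc k)) \<longlonglongrightarrow> \<bar>r\<bar> * 0"
      by (intro tendsto_intros LIMSEQ_inverse_real_of_nat)
    then have "\<forall>\<^sub>F k in sequentially. \<bar>r\<bar> * inverse (Suc k) < e"
      using \<open>0 < e\<close> by (intro order_tendstoD(2)) auto
    then show "\<forall>\<^sub>F k in sequentially. \<forall>T\<in>?B. dist (T (d (\<sigma> z k))) (T z) < e"
    proof eventually_elim
      case (elim k)
      show ?case
      proof
        fix T assume "T \<in> ?B"
        then have "dist (T (d (\<sigma> z k))) (T z) \<le> r * dist (d (\<sigma> z k)) z"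
          by (rule operator_ball_dist)
        also have "\<dots> \<le> \<bar>r\<bar> * inverse (Suc k)"
          using \<sigma>[of z k] by (intro mult_mono) auto
        finally show "dist (T (d (\<sigma> z k))) (T z) < e"
          using elim by simp
      qed
    qed
  qed
  have \<Psi>\<Phi>: "\<Psi> (\<Phi> T) = T" if "T \<in> ?B" for T
    using tendsto_uniform_limitI[OF unif that] by (auto simp: \<Psi>_def \<Phi>_def intro!: limI)
  have cont\<Phi>: "continuous_on ?B \<Phi>"
    unfolding \<Phi>_def
    by (intro continuous_on_coordinatewise_then_product
        continuous_on_subset[OF continuous_on_product_coordinates]) simp
  have cont\<Psi>: "continuous_on (\<Phi> ` ?B) \<Psi>"
  proof (rule continuous_on_coordinatewise_then_product)
    fix z
    show "continuous_on (\<Phi> ` ?B) (\<lambda>g. \<Psi> g z)"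
    proof (rule uniform_limit_theorem)
      show "\<forall>\<^sub>F k in sequentially. continuous_on (\<Phi> ` ?B) (\<lambda>g. g (\<sigma> z k))"
        by (intro always_eventually allI continuous_on_subset[OF continuous_on_product_coordinates]) simp
      show "uniform_limit (\<Phi> ` ?B) (\<lambda>k g. g (\<sigma> z k)) (\<lambda>g. \<Psi> g z) sequentially"
        using unif[of z] by (simp add: uniform_limit_iff \<Psi>\<Phi>) (simp add: \<Phi>_def)
    qed simp
  qed
  \<comment> \<open>Sequences suffice, since a countable power of a metric space is metrizable.
    Convergence in it means convergence on \<open>D\<close>, which
    \<open>operator_ball_pointwise_limit\<close> extends to all points.\<close>
  have "closed (\<Phi> ` ?B)"
    unfolding closed_sequential_limits
  proof (intro allI impI, elim conjE)
    fix X g assume "\<forall>i. X i \<in> \<Phi> ` ?B" and lim: "X \<longlonglongrightarrow> g"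
    then have "\<forall>i. \<exists>T. T \<in> ?B \<and> X i = \<Phi> T"
      by blast
    then obtain T where T: "\<And>i. T i \<in> ?B" "\<And>i. X i = \<Phi> (T i)"
      using choice[of "\<lambda>i T. T \<in> ?B \<and> X i = \<Phi> T"] by blast
    have g: "(\<lambda>i. T i (d n)) \<longlonglongrightarrow> g n" for n
    proof -
      have "isCont (\<lambda>g. g n) g" for g :: "nat \<Rightarrow> 'a"
        by (rule continuous_on_interior[OF continuous_on_product_coordinates]) simp
      from isCont_tendsto_compose[OF this lim] show ?thesis
        by (simp add: T(2) \<Phi>_def)
    qed
    then have "convergent (\<lambda>i. T i x)" if "x \<in> D" for x
      using that d by (force simp: convergent_def)
    then obtain S where S: "S \<in> ?B" "\<And>x. (\<lambda>i. T i x) \<longlonglongrightarrow> S x"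
      using operator_ball_pointwise_limit[of T, OF T(1) D] by blast
    have "g = \<Phi> S"
      using LIMSEQ_unique[OF g S(2)] by (auto simp: \<Phi>_def)
    then show "g \<in> \<Phi> ` ?B"
      using S(1) by blast
  qed
  then have "completely_metrizable_space (top_of_set (\<Phi> ` ?B))"
    using completely_metrizable_space_closedin completely_metrizable_space_euclidean closed_closedin
    by blast
  moreover have "homeomorphic_maps (top_of_set ?B) (top_of_set (\<Phi> ` ?B)) \<Phi> \<Psi>"
    using cont\<Phi> cont\<Psi> \<Psi>\<Phi> by (auto simp: homeomorphic_maps_def continuous_map_in_subtopology)
  ultimately show ?thesis
    using homeomorphic_completely_metrizable_space homeomorphic_space_def by blast
qed

end

section \<open>Hypercyclicity as a family of open conditions, and Baire category\<close>

text \<open>Balls with centres in \<open>D\<close> and radii \<open>inverse (Suc k)\<close> suffice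
  to test density; for countable \<open>D\<close> these are countably many conditions.\<close>

lemma hypercyclic_vector_iff:
  fixes T :: "'a::metric_space \<Rightarrow> 'a"
  assumes "closure D = UNIV"
  shows "hypercyclic_vector T x \<longleftrightarrow> (\<forall>y\<in>D. \<forall>k. \<exists>n. (T ^^ n) x \<in> ball y (inverse (Suc k)))"
proof
  assume "hypercyclic_vector T x"
  then show "\<forall>y\<in>D. \<forall>k. \<exists>n. (T ^^ n) x \<in> ball y (inverse (Suc k))"
    unfolding hypercyclic_vector_def set_eq_iff closure_approachable
    by (auto simp: dist_commute)
next
  assume *: "\<forall>y\<in>D. \<forall>k. \<exists>n. (T ^^ n) x \<in> ball y (inverse (Suc k))"
  have "D \<subseteq> closure (range (\<lambda>n. (T ^^ n) x))"
  proof
    fix y assume y: "y \<in> D"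
    show "y \<in> closure (range (\<lambda>n. (T ^^ n) x))"
      unfolding closure_approachable
    proof (intro allI impI)
      fix e :: real assume "0 < e"
      then obtain k where "inverse (Suc k) < e"
        using reals_Archimedean by blast
      moreover obtain n where "(T ^^ n) x \<in> ball y (inverse (Suc k))"
        using * y by blast
      ultimately show "\<exists>z\<in>range (\<lambda>n. (T ^^ n) x). dist z y < e"
        by (auto simp: dist_commute intro: less_trans)
    qed
  qed
  then have "closure D \<subseteq> closure (range (\<lambda>n. (T ^^ n) x))"
    by (simp add: closure_minimal)
  then show "hypercyclic_vector T x"
    using assms by (auto simp: hypercyclic_vector_def)
qed

theorem theorem1:
  fixes smul :: "complex \<Rightarrow> 'a::banach \<Rightarrow> 'a"
    and ip :: "'a \<Rightarrow> 'a \<Rightarrow> complex"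
    and D :: "'a set"
    and R :: real
    and B :: "('a \<Rightarrow> 'a) set"
  assumes "complex_inner_space smul ip"
    and "separable_space TYPE('a)"
    and "complex_infinite_dimensional smul"
    and "countable D" and "0 \<notin> D" and "closure D = UNIV"
    and "R > 1"
  defines "B \<equiv> {T. bounded_complex_linear smul T \<and> onorm T \<le> R}"
  shows "gdelta_in (subtopology euclidean B) {T \<in> B. \<forall>x\<in>D. hypercyclic_vector T x}
    \<and> (subtopology euclidean B) closure_of {T \<in> B. \<forall>x\<in>D. hypercyclic_vector T x} = B"
proof -
  interpret complex_hilbert smul ip
    by unfold_locales fact
  have B: "B = operator_ball R"
    using bounded_complex_linear_onorm_eq[of R] \<open>R > 1\<close> by (simp add: B_def)
  \<comment> \<open>The set \<open>D\<close> serves twice: as the vectors whose orbits must be dense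
    and as the centres of the balls to be visited.\<close>
  define \<G> where "\<G> = 
    (\<Union>x\<in>D. \<Union>y\<in>D. \<Union>k. {{T \<in> B. \<exists>n. (T ^^ n) x \<in> ball y (inverse (Suc k))}})"
  have "countable \<G>"
    using \<open>countable D\<close> by (simp add: \<G>_def)
  have "D \<noteq> {}"
    using \<open>closure D = UNIV\<close> by auto
  then have "\<G> \<noteq> {}"
    by (simp add: \<G>_def)
  have HC: "{T \<in> B. \<forall>x\<in>D. hypercyclic_vector T x} = \<Inter>\<G>"
    using \<open>D \<noteq> {}\<close> by (auto simp: \<G>_def hypercyclic_vector_iff[OF \<open>closure D = UNIV\<close>])
  have open_dense: "openin (top_of_set B) G \<and> top_of_set B closure_of G = B" if G_in: "G \<in> \<G>" for G
  proof -
    obtain x y k where G: "G = {T \<in> B. \<exists>n. (T ^^ n) x \<in> ball y (inverse (Suc k))}" and "x \<in> D"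
      using G_in unfolding \<G>_def by blast
    then have "x \<noteq> 0"
      using \<open>0 \<notin> D\<close> by auto
    then show ?thesis
      unfolding G B using assms by (intro conjI openin_orbit_meets dense_orbit_meets) auto
  qed
  have "completely_metrizable_space (top_of_set B)"
    unfolding B using \<open>R > 1\<close> \<open>countable D\<close> \<open>closure D = UNIV\<close>
    by (intro completely_metrizable_operator_ball) auto
  then have "top_of_set B closure_of \<Inter>\<G> = B"
    using Baire_category[of "top_of_set B" \<G>] \<open>countable \<G>\<close> open_dense by simp
  moreover have "gdelta_in (top_of_set B) (\<Inter>\<G>)"
    using \<open>countable \<G>\<close> \<open>\<G> \<noteq> {}\<close> open_dense by (intro gdelta_in_Inter open_imp_gdelta_in) auto
  ultimately show ?thesis
    unfolding HC by simp
qed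

end
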